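(* On matching markets with resource-regional caps in which colleges' preferences are fully aligned, i.e., $\succ_c\,=\,\succ_{c'}$ for all $c,c'\in\mathcal{C}$, the mechanism CSD is stable (it always outputs a stable matching) and strategy-proof.
   Context: A matching market with resource-regional caps consists of: finite sets $\mathcal{S}$ (students), $\mathcal{C}$ (colleges), $\mathcal{R}$ (non-empty resources), and an additional empty resource $r_0$, with $\mathcal{R}_0=\mathcal{R}\cup\{r_0\}$; a quota $q_c>0$ for each $c\in\mathcal{C}$; for each $r\in\mathcal{R}$ a non-empty region $C_r\subseteq\mathcal{C}$ (regions may overlap) and a cap $q_r>0$; by convention $C_{r_0}=\mathcal{C}$ and $q_{r_0}=|\mathcal{S}|$; for each college $c$ a strict ranking $\succ_c$ of $\mathcal{S}$; for each student $s$ a strict ranking $\succ_s$ of $(\mathcal{C}\times\mathcal{R}_0)\cup\{\emptyset\}$. A pair $(c,r)$ is acceptable for $s$ if $(c,r)\succ_s\emptyset$. It is assumed that whenever $r\in\mathcal{R}$ and $(c,r)$ is acceptable for $s$, $(c,r)\succ_s(c,r_0)$. The set of contracts is $\mathcal{X}=\mathcal{S}\times\mathcal{C}\times\mathcal{R}_0$. A matching $\mu$ is a subset of $\mathcal{X}$ in which each student appears in at most one contract; $\mu_s$ denotes the contract of $s$ in $\mu$ (also identified with its college-resource pair), with $\mu_s=\emptyset$ if $s$ is unmatched (and then $\mu\setminus\{\mu_s\}=\mu$). $\mu$ is feasible if each college $c$ is in at most $q_c$ contracts of $\mu$, and for each $r\in\mathcal{R}$ at most $q_r$ contracts of $\mu$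 contain $r$, all of them with colleges in $C_r$. $\mu$ is individually rational if $(c,r)\succ_s\emptyset$ for each $(s,c,r)\in\mu$. Let $\mu$ be feasible and individually rational. A contract $(s,c,r)\in\mathcal{X}\setminus\mu$ envy-blocks $\mu$ through $(s',c,r')\in\mu$ if $(c,r)\succ_s\mu_s$, $s\succ_c s'$, and $(\mu\setminus\{\mu_s,(s',c,r')\})\cup\{(s,c,r)\}$ is feasible. It waste-blocks $\mu$ if $(c,r)\succ_s\mu_s$ and $(\mu\setminus\{\mu_s\})\cup\{(s,c,r)\}$ is feasible. A feasible individually rational matching is stable if it has no envy-blocking and no waste-blocking contracts. A mechanism is strategy-proof (on a class of markets) if no agent (student) can obtain a strictly better contract, with respect to her true preferences, by misreporting her preferences, for any market in the class. Given a feasible matching $\mu$ and a student $s$ unmatched in $\mu$, let $x_s^\mu$ be the most preferred acceptable contract of $s$ such that $\mu\cup\{x_s^\mu\}$ is feasible ($x_s^\mu$ is empty if there is none). Controlled Serial Dictatorship (CSD): start with the empty matching. At each iteration, with current matching $\mu$, consider the non-empty contracts $x_s^\mu=(s,c,r)$ of the currently unmatched students $s$, and add to $\mu$ the one for which the rank (position) of $s$ in $\succ_c$ is best (rank 1 being the most preferred student of $c$), breaking ties uniformly at random. Stop when all students are matched or $x_s^\mu$ is empty for all unmatched $s$, and output $\mu$. *)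

theory Defs
  imports "HOL-Probability.Probability_Mass_Function"
begin

text \<open>
  An element of type \<open>'r option\<close> is a resource, \<open>None\<close> being the empty resource \<open>r\<^sub>0\<close>.
  Students rank elements of type \<open>('c \<times> 'r option) option\<close>, where the outer \<open>None\<close> is the
  outside option \<open>\<emptyset>\<close> (being unmatched).  Rankings are strict: \<open>(a, b)\<close> in a ranking
  means that \<open>a\<close> is preferred to \<open>b\<close>.
\<close>

type_synonym ('c, 'r) alternative = "('c \<times> 'r option) option"
type_synonym ('s, 'c, 'r) contract = "'s \<times> 'c \<times> 'r option"

record ('s, 'c, 'r) market =
  students :: "'s set"
  colleges :: "'c set"
  resources :: "'r set"
  quota :: "'c \<Rightarrow> nat"
  region :: "'r option \<Rightarrow> 'c set"
  cap :: "'r option \<Rightarrow> nat"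
  college_pref :: "'c \<Rightarrow> 's rel"
  student_pref :: "'s \<Rightarrow> ('c, 'r) alternative rel"

definition strict_ranking :: "'a set \<Rightarrow> 'a rel \<Rightarrow> bool" where
  "strict_ranking A P \<longleftrightarrow> P \<subseteq> A \<times> A \<and> strict_linear_order_on A P"

definition resources0 :: "('s, 'c, 'r) market \<Rightarrow> 'r option set" where
  "resources0 M = insert None (Some ` resources M)"

definition alternatives :: "('s, 'c, 'r) market \<Rightarrow> ('c, 'r) alternative set" where
  "alternatives M = insert None (Some ` (colleges M \<times> resources0 M))"

definition acceptable :: "('s, 'c, 'r) market \<Rightarrow> 's \<Rightarrow> 'c \<times> 'r option \<Rightarrow> bool" where
  "acceptable M s p \<longleftrightarrow> (Some p, None) \<in> student_pref M s"

definition is_market :: "('s, 'c, 'r) market \<Rightarrow> bool" where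
  "is_market M \<longleftrightarrow>
     finite (students M) \<and> finite (colleges M) \<and> finite (resources M) \<and>
     (\<forall>c\<in>colleges M. quota M c > 0) \<and>
     (\<forall>r\<in>resources M. region M (Some r) \<noteq> {} \<and> region M (Some r) \<subseteq> colleges M \<and>
        cap M (Some r) > 0) \<and>
     region M None = colleges M \<and> cap M None = card (students M) \<and>
     (\<forall>c\<in>colleges M. strict_ranking (students M) (college_pref M c)) \<and>
     (\<forall>s\<in>students M. strict_ranking (alternatives M) (student_pref M s)) \<and>
     (\<forall>s\<in>students M. \<forall>c\<in>colleges M. \<forall>r\<in>resources M. acceptable M s (c, Some r) \<longrightarrow>
        (Some (c, Some r), Some (c, None)) \<in> student_pref M s)"

definition contracts :: "('s, 'c, 'r) market \<Rightarrow> ('s, 'c, 'r) contract set" where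
  "contracts M = students M \<times> colleges M \<times> resources0 M"

definition matching :: "('s, 'c, 'r) market \<Rightarrow> ('s, 'c, 'r) contract set \<Rightarrow> bool" where
  "matching M \<mu> \<longleftrightarrow> \<mu> \<subseteq> contracts M \<and> (\<forall>s p p'. (s, p) \<in> \<mu> \<longrightarrow> (s, p') \<in> \<mu> \<longrightarrow> p = p')"

definition assigned :: "('s, 'c, 'r) contract set \<Rightarrow> 's \<Rightarrow> ('c, 'r) alternative" where
  "assigned \<mu> s = (if \<exists>p. (s, p) \<in> \<mu> then Some (THE p. (s, p) \<in> \<mu>) else None)"

definition drop_student :: "('s, 'c, 'r) contract set \<Rightarrow> 's \<Rightarrow> ('s, 'c, 'r) contract set" where
  "drop_student \<mu> s = {x \<in> \<mu>. fst x \<noteq> s}"  \<comment> \<open>\<open>\<mu> \<setminus> {\<mu>\<^sub>s}\<close>\<close>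

definition feasible :: "('s, 'c, 'r) market \<Rightarrow> ('s, 'c, 'r) contract set \<Rightarrow> bool" where
  "feasible M \<mu> \<longleftrightarrow> matching M \<mu> \<and>
     (\<forall>c\<in>colleges M. card {(s, c', r) \<in> \<mu>. c' = c} \<le> quota M c) \<and>
     (\<forall>r\<in>resources M. card {(s, c, r') \<in> \<mu>. r' = Some r} \<le> cap M (Some r) \<and>
        (\<forall>s c. (s, c, Some r) \<in> \<mu> \<longrightarrow> c \<in> region M (Some r)))"

definition individually_rational ::
  "('s, 'c, 'r) market \<Rightarrow> ('s, 'c, 'r) contract set \<Rightarrow> bool" where
  "individually_rational M \<mu> \<longleftrightarrow> (\<forall>(s, p)\<in>\<mu>. acceptable M s p)"

definition envy_blocks_through ::
  "('s, 'c, 'r) market \<Rightarrow> ('s, 'c, 'r) contract set \<Rightarrow>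
     ('s, 'c, 'r) contract \<Rightarrow> ('s, 'c, 'r) contract \<Rightarrow> bool" where
  "envy_blocks_through M \<mu> = (\<lambda>(s, c, r) (s', c', r').
     (s, c, r) \<in> contracts M - \<mu> \<and> (s', c', r') \<in> \<mu> \<and> c' = c \<and>
     (Some (c, r), assigned \<mu> s) \<in> student_pref M s \<and>
     (s, s') \<in> college_pref M c \<and>
     feasible M (insert (s, c, r) (drop_student \<mu> s - {(s', c', r')})))"

definition waste_blocks ::
  "('s, 'c, 'r) market \<Rightarrow> ('s, 'c, 'r) contract set \<Rightarrow> ('s, 'c, 'r) contract \<Rightarrow> bool" where
  "waste_blocks M \<mu> = (\<lambda>(s, c, r).
     (s, c, r) \<in> contracts M - \<mu> \<and>
     (Some (c, r), assigned \<mu> s) \<in> student_pref M s \<and>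
     feasible M (insert (s, c, r) (drop_student \<mu> s)))"

definition stable :: "('s, 'c, 'r) market \<Rightarrow> ('s, 'c, 'r) contract set \<Rightarrow> bool" where
  "stable M \<mu> \<longleftrightarrow> feasible M \<mu> \<and> individually_rational M \<mu> \<and>
     (\<nexists>x y. envy_blocks_through M \<mu> x y) \<and> (\<nexists>x. waste_blocks M \<mu> x)"

text \<open>A mechanism may break ties at random, so it maps a market to a distribution over
  matchings.\<close>

type_synonym ('s, 'c, 'r) mechanism =
  "('s, 'c, 'r) market \<Rightarrow> ('s, 'c, 'r) contract set pmf"

definition stable_mechanism_on ::
  "('s, 'c, 'r) market set \<Rightarrow> ('s, 'c, 'r) mechanism \<Rightarrow> bool" where
  "stable_mechanism_on D \<phi> \<longleftrightarrow> (\<forall>M\<in>D. \<forall>\<mu>\<in>set_pmf (\<phi> M). stable M \<mu>)"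

definition misreport ::
  "('s, 'c, 'r) market \<Rightarrow> 's \<Rightarrow> ('c, 'r) alternative rel \<Rightarrow> ('s, 'c, 'r) market" where
  "misreport M s P = M\<lparr>student_pref := (student_pref M)(s := P)\<rparr>"

text \<open>Strategy-proofness is required outcome by outcome: no outcome that can arise after a
  misreport is truly preferred to an outcome that can arise under truth-telling.  Every strict
  ranking may be reported, including one that fails the standing assumption of
  \<open>is_market\<close> on student preferences.\<close>

definition strategy_proof_on ::
  "('s, 'c, 'r) market set \<Rightarrow> ('s, 'c, 'r) mechanism \<Rightarrow> bool" where
  "strategy_proof_on D \<phi> \<longleftrightarrow>
     (\<forall>M\<in>D. \<forall>s\<in>students M. \<forall>P. strict_ranking (alternatives M) P \<longrightarrow>
        (\<forall>\<mu>\<in>set_pmf (\<phi> M). \<forall>\<mu>'\<in>set_pmf (\<phi> (misreport M s P)).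
           (assigned \<mu>' s, assigned \<mu> s) \<notin> student_pref M s))"

definition aligned_markets :: "('s, 'c, 'r) market set" where
  "aligned_markets = {M. is_market M \<and>
     (\<forall>c\<in>colleges M. \<forall>c'\<in>colleges M. college_pref M c = college_pref M c')}"

definition unmatched :: "('s, 'c, 'r) market \<Rightarrow> ('s, 'c, 'r) contract set \<Rightarrow> 's set" where
  "unmatched M \<mu> = {s \<in> students M. \<nexists>p. (s, p) \<in> \<mu>}"

definition available ::
  "('s, 'c, 'r) market \<Rightarrow> ('s, 'c, 'r) contract set \<Rightarrow> 's \<Rightarrow> ('c \<times> 'r option) set" where
  "available M \<mu> s =
     {p \<in> colleges M \<times> resources0 M. acceptable M s p \<and> feasible M (insert (s, p) \<mu>)}"

text \<open>The contract \<open>x\<close> that the serial dictatorship considers for the student \<open>s\<close>;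
  \<open>None\<close> stands for the empty contract.\<close>

definition best_available ::
  "('s, 'c, 'r) market \<Rightarrow> ('s, 'c, 'r) contract set \<Rightarrow> 's \<Rightarrow> ('c, 'r) alternative" where
  "best_available M \<mu> s =
     (if available M \<mu> s = {} then None
      else Some (THE p. p \<in> available M \<mu> s \<and>
        (\<forall>q\<in>available M \<mu> s. q \<noteq> p \<longrightarrow> (Some p, Some q) \<in> student_pref M s)))"

definition college_rank :: "('s, 'c, 'r) market \<Rightarrow> 'c \<Rightarrow> 's \<Rightarrow> nat" where
  "college_rank M c s = Suc (card {s' \<in> students M. (s', s) \<in> college_pref M c})"

definition csd_proposals ::
  "('s, 'c, 'r) market \<Rightarrow> ('s, 'c, 'r) contract set \<Rightarrow> ('s, 'c, 'r) contract set" where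
  "csd_proposals M \<mu> = {(s, p). s \<in> unmatched M \<mu> \<and> best_available M \<mu> s = Some p}"

definition csd_next ::
  "('s, 'c, 'r) market \<Rightarrow> ('s, 'c, 'r) contract set \<Rightarrow> ('s, 'c, 'r) contract set" where
  "csd_next M \<mu> =
     {x. is_arg_min (\<lambda>(s, c, r). college_rank M c s) (\<lambda>x. x \<in> csd_proposals M \<mu>) x}"

lemma csd_next_subset: "csd_next M \<mu> \<subseteq> csd_proposals M \<mu>"
  by (auto simp: csd_next_def is_arg_min_def)

lemma finite_csd_next:
  assumes "finite (students M)"
  shows "finite (csd_next M \<mu>)"
proof (rule finite_subset)
  show "csd_next M \<mu> \<subseteq> (\<lambda>s. (s, the (best_available M \<mu> s))) ` students M"
  proof
    fix x assume "x \<in> csd_next M \<mu>"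
    then have "x \<in> csd_proposals M \<mu>"
      using csd_next_subset by blast
    then have "fst x \<in> students M" "x = (fst x, the (best_available M \<mu> (fst x)))"
      unfolding csd_proposals_def unmatched_def by auto
    then show "x \<in> (\<lambda>s. (s, the (best_available M \<mu> s))) ` students M"
      by blast
  qed
qed (use assms in simp)

lemma card_unmatched_insert_less:
  assumes "finite (students M)" and "x \<in> csd_next M \<mu>"
  shows "card (unmatched M (insert x \<mu>)) < card (unmatched M \<mu>)"
proof (rule psubset_card_mono)
  show "finite (unmatched M \<mu>)"
    using assms(1) by (simp add: unmatched_def)
  obtain s p where x: "x = (s, p)"
    by (cases x)
  have "x \<in> csd_proposals M \<mu>"
    using assms(2) csd_next_subset by blast
  then have "s \<in> unmatched M \<mu>"
    by (simp add: csd_proposals_def x)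
  moreover have "s \<notin> unmatched M (insert x \<mu>)"
    unfolding unmatched_def x by blast
  moreover have "unmatched M (insert x \<mu>) \<subseteq> unmatched M \<mu>"
    unfolding unmatched_def by blast
  ultimately show "unmatched M (insert x \<mu>) \<subset> unmatched M \<mu>"
    by blast
qed

text \<open>The test for finiteness only serves to make the recursion terminate on records that are not
  markets.\<close>

function csd_from ::
  "('s, 'c, 'r) market \<Rightarrow> ('s, 'c, 'r) contract set \<Rightarrow> ('s, 'c, 'r) contract set pmf" where
  "csd_from M \<mu> =
     (if finite (students M) \<and> csd_next M \<mu> \<noteq> {}
      then bind_pmf (pmf_of_set (csd_next M \<mu>)) (\<lambda>x. csd_from M (insert x \<mu>))
      else return_pmf \<mu>)"
  by pat_completeness simp
termination
proof (relation "Wellfounded.measure (\<lambda>(M, \<mu>). card (unmatched M \<mu>))", goal_cases)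
  case 1
  show ?case by (rule wf_measure)
next
  case (2 M \<mu> x)
  have "x \<in> csd_next M \<mu>"
    using 2 by (simp add: finite_csd_next)
  then show ?case
    using 2(1) by (simp add: card_unmatched_insert_less)
qed

declare csd_from.simps [simp del]

definition CSD :: "('s, 'c, 'r) mechanism" where
  "CSD M = csd_from M {}"

end

theory Submission
  imports Defs
begin

text \<open>
  With a common ranking of the students, CSD is a serial dictatorship: every student receives
  her best contract that is feasible together with the contracts of the students ranked above
  her.  This determines the outcome, and it yields both claims.  A contract that a student
  prefers to her own is infeasible already with the contracts of higher-ranked students, and these
  survive the removals in the definition of a blocking contract.  A misreport does not change
  the contracts of higher-ranked students, so it only selects another contract from the same
  feasible set.
\<close>

section \<open>Strict orders, matchings and feasibility\<close>

lemma strict_linear_order_asym: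
  assumes "strict_linear_order_on A R" "(a, b) \<in> R" "(b, a) \<in> R"
  shows False
  using assms unfolding strict_linear_order_on_def by (meson irrefl_def transD)

lemma strict_linear_order_ex_top:
  assumes "strict_linear_order_on A R" "finite B" "B \<noteq> {}" "B \<subseteq> A"
  shows "\<exists>b\<in>B. \<forall>b'\<in>B. b' \<noteq> b \<longrightarrow> (b, b') \<in> R"
  using assms(2-4)
proof (induction B rule: finite_ne_induct)
  case (insert x F)
  then obtain b where b: "b \<in> F" "\<forall>b'\<in>F. b' \<noteq> b \<longrightarrow> (b, b') \<in> R"
    by auto
  have "x \<noteq> b" using b insert by blast
  then consider "(x, b) \<in> R" | "(b, x) \<in> R"
    using assms(1) b(1) insert.prems unfolding strict_linear_order_on_def total_on_def by blast
  then show ?case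
  proof cases
    case 1
    then have "\<forall>b'\<in>insert x F. b' \<noteq> x \<longrightarrow> (x, b') \<in> R"
      using assms(1) b unfolding strict_linear_order_on_def by (metis insertE transD)
    then show ?thesis by blast
  next
    case 2
    then show ?thesis using b by blast
  qed
qed simp

lemma assigned_eq_Some_iff:
  assumes "matching M \<mu>"
  shows "assigned \<mu> s = Some p \<longleftrightarrow> (s, p) \<in> \<mu>"
proof -
  have "(THE p'. (s, p') \<in> \<mu>) = q" if "(s, q) \<in> \<mu>" for q
    using assms that unfolding matching_def by blast
  then show ?thesis
    unfolding assigned_def by (metis option.distinct(1) option.inject)
qed

lemma finite_contracts:
  assumes "finite (students M)" "finite (colleges M)" "finite (resources M)"
  shows "finite (contracts M)"
  using assms by (simp add: contracts_def resources0_def)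

text \<open>Caps and quotas are upper bounds and the other constraints are universal statements
  about contracts, so all of them pass to subsets. Finiteness matters because \<open>card\<close> is
  0 on infinite sets.\<close>

lemma feasible_mono:
  assumes "finite \<mu>" "feasible M \<mu>" "\<nu> \<subseteq> \<mu>"
  shows "feasible M \<nu>"
proof -
  have "card {x \<in> \<nu>. Q x} \<le> card {x \<in> \<mu>. Q x}" for Q
    using assms(1,3) by (intro card_mono) auto
  from this[of "\<lambda>(s, c', r). c' = c" for c] this[of "\<lambda>(s, c, r'). r' = Some r" for r]
  have cards: "card {(s, c', r) \<in> \<nu>. c' = c} \<le> card {(s, c', r) \<in> \<mu>. c' = c}"
    "card {(s, c, r') \<in> \<nu>. r' = Some r} \<le> card {(s, c, r') \<in> \<mu>. r' = Some r}" for c r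
    by (simp_all add: case_prod_unfold)
  have "matching M \<mu>"
    using assms(2) by (simp add: feasible_def)
  then have "matching M \<nu>"
    using assms(3) unfolding matching_def by (meson order_trans subsetD)
  then show ?thesis
    using assms(2,3) unfolding feasible_def
    by (auto intro: order_trans[OF cards(1)] order_trans[OF cards(2)])
qed

section \<open>Serial dictatorship outcomes and intermediate stages\<close>

definition higher :: "'s rel \<Rightarrow> ('s, 'c, 'r) contract set \<Rightarrow> 's \<Rightarrow> ('s, 'c, 'r) contract set" where
  "higher L \<mu> s = {x \<in> \<mu>. (fst x, s) \<in> L}"

text \<open>One fixed-point equation per student instead of a recursion along \<open>L\<close>, so
  that the condition makes sense for any matching, without reference to the order in which its
  contracts were added.\<close>

definition serial_outcome ::
  "('s, 'c, 'r) market \<Rightarrow> 's rel \<Rightarrow> ('s, 'c, 'r) contract set \<Rightarrow> bool" where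
  "serial_outcome M L \<mu> \<longleftrightarrow> feasible M \<mu> \<and>
     (\<forall>s\<in>students M. assigned \<mu> s = best_available M (higher L \<mu> s) s)"

text \<open>The invariant of a run. The alternative \<open>higher L \<mu> s = \<mu>\<close> covers
  students not yet reached: everyone holding a contract ranks above them. A student passed over for
  lack of a contract satisfies the equation with both sides \<open>None\<close>.\<close>

definition serial_stage ::
  "('s, 'c, 'r) market \<Rightarrow> 's rel \<Rightarrow> ('s, 'c, 'r) contract set \<Rightarrow> bool" where
  "serial_stage M L \<mu> \<longleftrightarrow> feasible M \<mu> \<and>
     (\<forall>s\<in>students M. assigned \<mu> s = best_available M (higher L \<mu> s) s \<or> higher L \<mu> s = \<mu>)"

text \<open>The standing assumption on student preferences is left out, since a misreport may
  violate it.\<close>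

locale master_list =
  fixes M :: "('s, 'c, 'r) market" and L :: "'s rel"
  assumes finite_students: "finite (students M)"
    and finite_colleges: "finite (colleges M)"
    and finite_resources: "finite (resources M)"
    and master: "strict_ranking (students M) L"
    and college_pref_eq: "c \<in> colleges M \<Longrightarrow> college_pref M c = L"
    and student_ranking: "s \<in> students M \<Longrightarrow> strict_ranking (alternatives M) (student_pref M s)"
begin

lemma L_order: "strict_linear_order_on (students M) L" and L_subset: "L \<subseteq> students M \<times> students M"
  using master by (auto simp: strict_ranking_def)

lemma L_irrefl: "(s, s) \<notin> L"
  using L_order by (auto simp: strict_linear_order_on_def irrefl_def)

lemma L_trans: "(s, t) \<in> L \<Longrightarrow> (t, u) \<in> L \<Longrightarrow> (s, u) \<in> L"
  using L_order unfolding strict_linear_order_on_def by (meson transD)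

lemma L_total: "s \<in> students M \<Longrightarrow> t \<in> students M \<Longrightarrow> s \<noteq> t \<Longrightarrow> (s, t) \<in> L \<or> (t, s) \<in> L"
  using L_order unfolding strict_linear_order_on_def total_on_def by blast

text \<open>As \<open>(s, t) \<in> L\<close> places \<open>s\<close> above \<open>t\<close>,
  induction along \<open>L\<close> runs from the best-ranked student downwards.\<close>

lemma wf_L: "wf L"
proof (rule finite_acyclic_wf)
  show "finite L" using L_subset finite_students by (meson finite_SigmaI finite_subset)
  show "acyclic L"
    using L_order by (simp add: strict_linear_order_on_def acyclic_irrefl trancl_id)
qed

lemma feasible_finite: "feasible M \<mu> \<Longrightarrow> finite \<mu>"
  using finite_contracts[OF finite_students finite_colleges finite_resources]
  by (auto simp: feasible_def matching_def intro: finite_subset)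

lemma feasible_subset: "feasible M \<mu> \<Longrightarrow> \<nu> \<subseteq> \<mu> \<Longrightarrow> feasible M \<nu>"
  using feasible_mono feasible_finite by blast

section \<open>Available and best contracts\<close>

text \<open>By heredity of feasibility. Consequently a student who has run out of contracts never
  regains one while the matching grows, so passing her over is final.\<close>

lemma available_antimono:
  assumes "\<nu> \<subseteq> \<mu>"
  shows "available M \<mu> s \<subseteq> available M \<nu> s"
proof -
  have "feasible M (insert (s, p) \<nu>)" if "feasible M (insert (s, p) \<mu>)" for p
    using that insert_mono[OF assms] by (rule feasible_subset)
  then show ?thesis
    unfolding available_def by auto
qed

lemma best_available_eq_None_iff: "best_available M \<mu> s = None \<longleftrightarrow> available M \<mu> s = {}"
  by (simp add: best_available_def)

lemma best_available_SomeD: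
  assumes "s \<in> students M" "best_available M \<mu> s = Some p"
  shows "p \<in> available M \<mu> s"
    and "\<And>q. q \<in> available M \<mu> s \<Longrightarrow> q \<noteq> p \<Longrightarrow> (Some p, Some q) \<in> student_pref M s"
proof -
  let ?top = "\<lambda>p. p \<in> available M \<mu> s \<and>
    (\<forall>q\<in>available M \<mu> s. q \<noteq> p \<longrightarrow> (Some p, Some q) \<in> student_pref M s)"
  have R: "strict_linear_order_on (alternatives M) (student_pref M s)"
    using student_ranking[OF assms(1)] by (simp add: strict_ranking_def)
  have "available M \<mu> s \<noteq> {}"
    using assms(2) by (auto simp: best_available_def split: if_splits)
  moreover have "finite (available M \<mu> s)"
    using finite_colleges finite_resources unfolding available_def resources0_def by simp
  moreover have "Some ` available M \<mu> s \<subseteq> alternatives M"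
    unfolding available_def alternatives_def by blast
  \<comment> \<open>The ranking lives on alternatives, which include the outside option, so the top
    is taken in the image under \<open>Some\<close>. Asymmetry then makes it unique, which justifies
    the \<open>THE\<close> in \<open>best_available\<close>.\<close>
  ultimately have "\<exists>b\<in>Some ` available M \<mu> s. \<forall>b'\<in>Some ` available M \<mu> s.
      b' \<noteq> b \<longrightarrow> (b, b') \<in> student_pref M s"
    by (intro strict_linear_order_ex_top[OF R]) auto
  then obtain p' where p': "?top p'"
    by auto
  have "p'' = p'" if "?top p''" for p''
    using p' that strict_linear_order_asym[OF R] by metis
  with p' have "?top (THE p. ?top p)"
    by (rule theI)
  moreover have "(THE p. ?top p) = p"
    using assms(2) by (simp add: best_available_def split: if_splits)
  ultimately have "?top p" by simp
  then show "p \<in> available M \<mu> s"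
    and "\<And>q. q \<in> available M \<mu> s \<Longrightarrow> q \<noteq> p \<Longrightarrow> (Some p, Some q) \<in> student_pref M s"
    by blast+
qed

text \<open>The best available alternative is either the outside option or acceptable, so
  transitivity applies. Leaving \<open>a\<close> arbitrary lets \<open>a = None\<close> yield
  \<open>outside_not_preferred_to_best\<close>.\<close>

lemma preferred_to_best_acceptable:
  assumes s: "s \<in> students M" and pref: "(a, best_available M \<mu> s) \<in> student_pref M s"
  shows "(a, None) \<in> student_pref M s"
proof (cases "best_available M \<mu> s")
  case None
  then show ?thesis using pref by simp
next
  case (Some p)
  then have "(Some p, None) \<in> student_pref M s"
    using best_available_SomeD(1)[OF s Some] by (simp add: available_def acceptable_def)
  moreover have "trans (student_pref M s)"
    using student_ranking[OF s] by (simp add: strict_ranking_def strict_linear_order_on_def)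
  ultimately show ?thesis using pref Some by (metis transD)
qed

text \<open>Infeasibility is the only possible obstacle: \<open>q\<close> belongs to the market
  because the ranking lives on \<open>alternatives M\<close>, and it is acceptable by the previous
  lemma. If feasible it would be available and beat the best available contract. Both stability and
  strategy-proofness rest on this.\<close>

lemma preferred_to_best_infeasible:
  assumes s: "s \<in> students M" and pref: "(Some q, best_available M \<mu> s) \<in> student_pref M s"
  shows "\<not> feasible M (insert (s, q) \<mu>)"
proof
  assume "feasible M (insert (s, q) \<mu>)"
  moreover have R: "strict_linear_order_on (alternatives M) (student_pref M s)"
    and "student_pref M s \<subseteq> alternatives M \<times> alternatives M"
    using student_ranking[OF s] by (auto simp: strict_ranking_def)
  then have "q \<in> colleges M \<times> resources0 M"
    using pref unfolding alternatives_def by blast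
  moreover have "acceptable M s q"
    using preferred_to_best_acceptable[OF s pref] by (simp add: acceptable_def)
  ultimately have q: "q \<in> available M \<mu> s"
    by (simp add: available_def)
  then have "best_available M \<mu> s \<noteq> None"
    by (auto simp: best_available_eq_None_iff)
  then obtain p where p: "best_available M \<mu> s = Some p"
    by blast
  show False
  proof (cases "q = p")
    case True
    then show False using strict_linear_order_asym[OF R] pref p by metis
  next
    case False
    then show False
      using strict_linear_order_asym[OF R] pref p best_available_SomeD(2)[OF s p q] by metis
  qed
qed

lemma outside_not_preferred_to_best:
  assumes s: "s \<in> students M"
  shows "(None, best_available M \<mu> s) \<notin> student_pref M s"
proof
  assume "(None, best_available M \<mu> s) \<in> student_pref M s"
  from preferred_to_best_acceptable[OF s this] show False
    using student_ranking[OF s] strict_linear_order_asym unfolding strict_ranking_def by metis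
qed

section \<open>The contract added by CSD\<close>

text \<open>Ranks at different colleges are comparable because all are positions in
  \<open>L\<close>. The students above \<open>s'\<close> are also above \<open>s\<close>, and
  \<open>s'\<close> itself makes the inclusion proper.\<close>

lemma college_rank_less:
  assumes "c \<in> colleges M" "c' \<in> colleges M" "(s', s) \<in> L"
  shows "college_rank M c' s' < college_rank M c s"
proof -
  have "{t \<in> students M. (t, s') \<in> L} \<subset> {t \<in> students M. (t, s) \<in> L}"
    using assms(3) L_trans L_irrefl L_subset by blast
  then have "card {t \<in> students M. (t, s') \<in> L} < card {t \<in> students M. (t, s) \<in> L}"
    using finite_students by (simp add: psubset_card_mono)
  then show ?thesis
    using assms by (simp add: college_rank_def college_pref_eq)
qed

lemma csd_proposalsD:
  assumes "(s, p) \<in> csd_proposals M \<mu>"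
  shows "s \<in> students M" "assigned \<mu> s = None" "best_available M \<mu> s = Some p"
    "p \<in> available M \<mu> s"
proof -
  show s: "s \<in> students M" and "assigned \<mu> s = None" and p: "best_available M \<mu> s = Some p"
    using assms by (auto simp: csd_proposals_def unmatched_def assigned_def)
  from best_available_SomeD(1)[OF s p] show "p \<in> available M \<mu> s" .
qed

text \<open>A finite nonempty set of proposals has a minimizer, so the halting test of
  \<open>csd_from\<close> means that nobody proposes.\<close>

lemma csd_next_eq_empty_iff: "csd_next M \<mu> = {} \<longleftrightarrow> csd_proposals M \<mu> = {}"
proof
  assume empty: "csd_next M \<mu> = {}"
  have "csd_proposals M \<mu> \<subseteq> contracts M"
    using csd_proposalsD unfolding contracts_def available_def by fast
  then have "finite (csd_proposals M \<mu>)"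
    using finite_contracts finite_students finite_colleges finite_resources finite_subset by metis
  then show "csd_proposals M \<mu> = {}"
    using empty ex_is_arg_min_if_finite[of "csd_proposals M \<mu>" "\<lambda>(s, c, r). college_rank M c s"]
    unfolding csd_next_def by blast
qed (use csd_next_subset in blast)

text \<open>Here alignment enters: the smallest rank, compared across colleges, belongs to the
  highest-ranked proposer, whichever colleges the proposals name.\<close>

lemma csd_next_top:
  assumes "(s, p) \<in> csd_next M \<mu>" "(t, q) \<in> csd_proposals M \<mu>"
  shows "(t, s) \<notin> L"
proof
  assume L: "(t, s) \<in> L"
  have sp: "(s, p) \<in> csd_proposals M \<mu>"
    using assms(1) csd_next_subset by blast
  obtain c r c' r' where p: "p = (c, r)" and q: "q = (c', r')"
    by (cases p, cases q)
  have "c \<in> colleges M" "c' \<in> colleges M"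
    using csd_proposalsD(4)[OF sp] csd_proposalsD(4)[OF assms(2)]
    unfolding available_def p q by auto
  then have "college_rank M c' t < college_rank M c s"
    using college_rank_less L by blast
  moreover have "\<not> (case (t, c', r') of (s, c, r) \<Rightarrow> college_rank M c s)
      < (case (s, c, r) of (s, c, r) \<Rightarrow> college_rank M c s)"
    using assms unfolding csd_next_def is_arg_min_def p q by blast
  ultimately show False by simp
qed

lemma higher_eq_unmatched:
  assumes "s \<in> students M" "higher L \<mu> s = \<mu>"
  shows "s \<in> unmatched M \<mu>" "assigned \<mu> s = None"
proof -
  have "(s, p) \<notin> higher L \<mu> s" for p
    using L_irrefl by (simp add: higher_def)
  then show "s \<in> unmatched M \<mu>" "assigned \<mu> s = None"
    using assms by (auto simp: unmatched_def assigned_def)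
qed

section \<open>The invariant along a run\<close>

lemma serial_stage_empty: "serial_stage M L {}"
  by (auto simp: serial_stage_def feasible_def matching_def higher_def case_prod_unfold)

text \<open>All current contracts belong to students above the selected student \<open>s\<close>.
  Hence she receives her serial choice, students below her remain unreached, and unmatched students
  above her have nothing left to choose.\<close>

lemma serial_stage_insert:
  assumes stage: "serial_stage M L \<mu>" and nxt: "x \<in> csd_next M \<mu>"
  shows "serial_stage M L (insert x \<mu>)"
proof -
  obtain s p where x: "x = (s, p)"
    by (cases x)
  have proposal: "(s, p) \<in> csd_proposals M \<mu>"
    using nxt x csd_next_subset by blast
  note s = csd_proposalsD(1)[OF proposal] and unm = csd_proposalsD(2)[OF proposal]
    and best = csd_proposalsD(3)[OF proposal]
  have feas: "feasible M (insert x \<mu>)"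
    using csd_proposalsD(4)[OF proposal] by (simp add: available_def x)
  then have match: "matching M (insert x \<mu>)" "matching M \<mu>"
    using stage unfolding serial_stage_def feasible_def by blast+
  have no_avail: "available M \<mu> t = {}" if "best_available M (higher L \<mu> t) t = None" for t
    using that available_antimono[of "higher L \<mu> t" \<mu> t] best_available_eq_None_iff
    unfolding higher_def by blast
  \<comment> \<open>Otherwise \<open>s\<close> is already settled by her equation, and being
    unmatched she has no best contract over \<open>higher L \<mu> s\<close>. By antitonicity nothing
    is available to her at \<open>\<mu>\<close> either, although she proposes.\<close>
  have all_higher: "higher L \<mu> s = \<mu>"
  proof (rule ccontr)
    assume "higher L \<mu> s \<noteq> \<mu>"
    then have "best_available M (higher L \<mu> s) s = None"
      using stage s unm unfolding serial_stage_def by metis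
    then show False
      using no_avail csd_proposalsD(4)[OF proposal] by blast
  qed
  have "assigned (insert x \<mu>) t = best_available M (higher L (insert x \<mu>) t) t \<or>
      higher L (insert x \<mu>) t = insert x \<mu>" if t: "t \<in> students M" for t
  proof -
    consider "t = s" | "(s, t) \<in> L" | "(t, s) \<in> L" "t \<noteq> s"
      using L_total[OF s t] L_irrefl by blast
    then show ?thesis
    proof cases
      case 1
      have "higher L (insert x \<mu>) s = \<mu>"
        using all_higher L_irrefl unfolding higher_def x by auto
      moreover have "assigned (insert x \<mu>) s = Some p"
        using assigned_eq_Some_iff[OF match(1)] x by simp
      ultimately show ?thesis
        using best 1 by simp
    next
      case 2
      then have "higher L (insert x \<mu>) t = insert x \<mu>"
        using all_higher L_trans unfolding higher_def x by auto
      then show ?thesis ..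
    next
      case 3
      have "(s, t) \<notin> L"
        using 3 L_trans L_irrefl by blast
      then have hig: "higher L (insert x \<mu>) t = higher L \<mu> t"
        unfolding higher_def x by auto
      have asg: "assigned (insert x \<mu>) t = assigned \<mu> t"
        using 3 unfolding assigned_def x by simp
      show ?thesis
      proof (cases "assigned \<mu> t = best_available M (higher L \<mu> t) t")
        case True
        then show ?thesis using hig asg by simp
      next
        case False
        then have \<mu>: "higher L \<mu> t = \<mu>"
          using stage t unfolding serial_stage_def by blast
        have "t \<in> unmatched M \<mu>" and none: "assigned \<mu> t = None"
          using higher_eq_unmatched[OF t \<mu>] by auto
        \<comment> \<open>A proposal by \<open>t\<close>, who ranks above \<open>s\<close>, would
          have taken precedence over that of \<open>s\<close>. So \<open>t\<close> has no best
          contract, and remaining unmatched satisfies her equation.\<close>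
        have "best_available M \<mu> t \<noteq> Some q" for q
        proof
          assume "best_available M \<mu> t = Some q"
          with \<open>t \<in> unmatched M \<mu>\<close> have "(t, q) \<in> csd_proposals M \<mu>"
            by (simp add: csd_proposals_def)
          then show False
            using csd_next_top nxt x 3(1) by blast
        qed
        then have "best_available M \<mu> t = None"
          by (cases "best_available M \<mu> t") auto
        then show ?thesis using False none \<mu> by simp
      qed
    qed
  qed
  with feas show ?thesis
    unfolding serial_stage_def by (intro conjI ballI)
qed

text \<open>An unreached student is unmatched, and without proposals her best contract over
  \<open>\<mu>\<close> is empty, so her equation holds with both sides \<open>None\<close>.\<close>

lemma serial_stage_final:
  assumes stage: "serial_stage M L \<mu>" and final: "csd_next M \<mu> = {}"
  shows "serial_outcome M L \<mu>"
proof -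
  have "assigned \<mu> s = best_available M (higher L \<mu> s) s"
    if s: "s \<in> students M" and hig: "higher L \<mu> s = \<mu>" for s
  proof -
    note higher_eq_unmatched[OF s hig]
    moreover have "csd_proposals M \<mu> = {}"
      using final csd_next_eq_empty_iff by blast
    ultimately show ?thesis
      using hig unfolding csd_proposals_def by (cases "best_available M \<mu> s") auto
  qed
  then show ?thesis
    using stage unfolding serial_stage_def serial_outcome_def by metis
qed

text \<open>The invariant is followed along every branch of the random tie-breaking, hence the claim
  for each matching in the support. The induction uses the termination measure of
  \<open>csd_from\<close>.\<close>

lemma csd_from_serial_outcome:
  assumes "serial_stage M L \<mu>" "\<nu> \<in> set_pmf (csd_from M \<mu>)"
  shows "serial_outcome M L \<nu>"
  using assms
proof (induction "card (unmatched M \<mu>)" arbitrary: \<mu> rule: less_induct)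
  case less
  show ?case
  proof (cases "csd_next M \<mu> = {}")
    case True
    then have "\<nu> = \<mu>"
      using less.prems(2) by (subst (asm) csd_from.simps) simp
    then show ?thesis
      using serial_stage_final less.prems(1) True by simp
  next
    case False
    then obtain x where x: "x \<in> csd_next M \<mu>" "\<nu> \<in> set_pmf (csd_from M (insert x \<mu>))"
      using less.prems(2) finite_students
      by (subst (asm) csd_from.simps) (auto simp: finite_csd_next)
    show ?thesis
      by (rule less.hyps[OF card_unmatched_insert_less[OF finite_students x(1)]
            serial_stage_insert[OF less.prems(1) x(1)] x(2)])
  qed
qed

lemma CSD_serial_outcome: "\<mu> \<in> set_pmf (CSD M) \<Longrightarrow> serial_outcome M L \<mu>"
  unfolding CSD_def using csd_from_serial_outcome serial_stage_empty by blast

section \<open>Stability\<close>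

lemma serial_outcome_stable:
  assumes out: "serial_outcome M L \<mu>"
  shows "stable M \<mu>"
proof -
  have feas: "feasible M \<mu>"
    and best: "s \<in> students M \<Longrightarrow> assigned \<mu> s = best_available M (higher L \<mu> s) s" for s
    using out by (auto simp: serial_outcome_def)
  have match: "matching M \<mu>"
    using feas by (simp add: feasible_def)
  have "acceptable M s p" if "(s, p) \<in> \<mu>" for s p
  proof -
    have s: "s \<in> students M"
      using match that unfolding matching_def contracts_def by blast
    then have "best_available M (higher L \<mu> s) s = Some p"
      using best assigned_eq_Some_iff[OF match] that by metis
    then show ?thesis
      using best_available_SomeD(1)[OF s] unfolding available_def by blast
  qed
  then have ir: "individually_rational M \<mu>"
    unfolding individually_rational_def by blast
  \<comment> \<open>Treats both kinds of blocking at once: it suffices that the removals leave the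
    contracts in \<open>higher L \<mu> s\<close> untouched.\<close>
  have infeasible: "\<not> feasible M (insert (s, q) \<nu>)"
    if "s \<in> students M" "(Some q, assigned \<mu> s) \<in> student_pref M s" "higher L \<mu> s \<subseteq> \<nu>" for s q \<nu>
  proof
    assume "feasible M (insert (s, q) \<nu>)"
    then have "feasible M (insert (s, q) (higher L \<mu> s))"
      using that(3) by (blast intro: feasible_subset)
    then show False
      using preferred_to_best_infeasible that(1,2) best by metis
  qed
  have drop: "higher L \<mu> s \<subseteq> drop_student \<mu> s" for s
    using L_irrefl unfolding higher_def drop_student_def by auto
  have waste: "\<not> waste_blocks M \<mu> x" for x
    using infeasible[OF _ _ drop] unfolding waste_blocks_def contracts_def by auto
  have envy: "\<not> envy_blocks_through M \<mu> x y" for x y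
  proof
    assume envy: "envy_blocks_through M \<mu> x y"
    obtain s c r s' c' r' where "x = (s, c, r)" "y = (s', c', r')"
      by (cases x, cases y)
    then have s: "s \<in> students M" and c: "c \<in> colleges M"
      and pref: "(Some (c, r), assigned \<mu> s) \<in> student_pref M s"
      and s': "(s, s') \<in> college_pref M c"
      and block: "feasible M (insert (s, c, r) (drop_student \<mu> s - {(s', c', r')}))"
      using envy unfolding envy_blocks_through_def contracts_def by auto
    \<comment> \<open>The envied student ranks below \<open>s\<close>, so removing her contract
      takes nothing from \<open>higher L \<mu> s\<close>.\<close>
    have "(s', s) \<notin> L"
      using s' c college_pref_eq L_trans L_irrefl by blast
    then have "higher L \<mu> s \<subseteq> drop_student \<mu> s - {(s', c', r')}"
      using drop[of s] unfolding higher_def by auto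
    then show False
      using infeasible[OF s pref] block by blast
  qed
  show ?thesis
    unfolding Defs.stable_def using feas ir envy waste by blast
qed

section \<open>Strategy-proofness\<close>

lemma master_list_misreport:
  assumes "strict_ranking (alternatives M) P"
  shows "master_list (misreport M s P) L"
proof -
  have "alternatives (misreport M s P) = alternatives M"
    by (simp add: misreport_def alternatives_def resources0_def)
  then show ?thesis
    using finite_students finite_colleges finite_resources master college_pref_eq
      student_ranking assms
    by (simp add: master_list_def misreport_def)
qed

lemma serial_outcome_misreport:
  assumes out: "serial_outcome M L \<mu>" and out': "serial_outcome (misreport M s P) L \<mu>'"
    and s: "s \<in> students M"
    and P: "strict_ranking (alternatives M) P"
  shows "(assigned \<mu>' s, assigned \<mu> s) \<notin> student_pref M s"
proof -
  let ?M' = "misreport M s P"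
  \<comment> \<open>Feasibility does not mention student preferences, so it is the same notion in
    the true and in the reported market.\<close>
  have fields: "students ?M' = students M" "colleges ?M' = colleges M"
    "resources0 ?M' = resources0 M" "feasible ?M' = feasible M"
    by (auto simp: fun_eq_iff misreport_def resources0_def feasible_def matching_def contracts_def)
  interpret M': master_list ?M' L
    using P by (rule master_list_misreport)
  have same_best: "best_available ?M' \<nu> t = best_available M \<nu> t" if "t \<noteq> s" for t \<nu>
    using that unfolding best_available_def available_def acceptable_def fields
    by (simp add: misreport_def)
  have match: "matching M \<mu>" "matching M \<mu>'"
    using out out' unfolding serial_outcome_def fields feasible_def by simp_all
  \<comment> \<open>Downward induction through the students above \<open>s\<close>: each faces the
    same contracts under both reports and has an unchanged ranking, so she makes the same choice.
    Admitting \<open>t = s\<close> gives the set that \<open>s\<close> herself faces.\<close>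
  have same: "t = s \<or> (t, s) \<in> L \<Longrightarrow> higher L \<mu> t = higher L \<mu>' t" for t
  proof (induction t rule: wf_induct_rule[OF wf_L])
    case (1 t)
    have "(u, p) \<in> \<mu> \<longleftrightarrow> (u, p) \<in> \<mu>'" if u: "(u, t) \<in> L" for u p
    proof -
      have us: "(u, s) \<in> L"
        using 1(2) u L_trans by blast
      then have "u \<noteq> s" "u \<in> students M"
        using L_irrefl L_subset by auto
      moreover have "higher L \<mu> u = higher L \<mu>' u"
        using 1(1)[OF u] us by blast
      ultimately have "assigned \<mu> u = assigned \<mu>' u"
        using out out' same_best unfolding serial_outcome_def fields by simp
      then show ?thesis
        using assigned_eq_Some_iff[OF match(1)] assigned_eq_Some_iff[OF match(2)] by metis
    qed
    then show ?case
      unfolding higher_def by auto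
  qed
  define \<nu> where "\<nu> = higher L \<mu> s"
  have truth: "assigned \<mu> s = best_available M \<nu> s"
    and lie: "assigned \<mu>' s = best_available ?M' \<nu> s"
    using out out' s same[of s] unfolding serial_outcome_def fields \<nu>_def by auto
  show ?thesis
  proof (cases "assigned \<mu>' s")
    case None
    then show ?thesis
      using outside_not_preferred_to_best[OF s] truth by simp
  next
    case (Some q)
    then have "q \<in> available ?M' \<nu> s"
      using M'.best_available_SomeD(1) lie s fields by metis
    \<comment> \<open>Acceptability in \<open>available ?M' \<nu> s\<close> refers to the reported
      ranking \<open>P\<close>; only feasibility is carried back to \<open>M\<close>.\<close>
    then have "feasible M (insert (s, q) \<nu>)"
      by (simp add: available_def fields)
    then show ?thesis
      using preferred_to_best_infeasible[OF s] truth Some by metis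
  qed
qed

end

section \<open>Master lists of aligned markets and the conclusion\<close>

lemma aligned_market_master_list:
  assumes "M \<in> aligned_markets"
  obtains L where "master_list M L"
proof -
  have M: "is_market M"
    and aligned: "\<And>c c'. c \<in> colleges M \<Longrightarrow> c' \<in> colleges M \<Longrightarrow> college_pref M c = college_pref M c'"
    using assms unfolding aligned_markets_def by blast+
  have "\<exists>L. strict_ranking (students M) L \<and> (\<forall>c\<in>colleges M. college_pref M c = L)"
  proof (cases "colleges M = {}")
    \<comment> \<open>No college supplies a ranking here, so an arbitrary strict ranking of the
      students is built by removing the diagonal from a well-order.\<close>
    case True
    obtain W where "well_order_on (students M) W"
      using well_order_on by blast
    then have "strict_linear_order_on (students M) (W - Id)" "W \<subseteq> students M \<times> students M"
      using strict_linear_order_on_diff_Id well_order_on_domain[of "students M" W]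
      by (auto simp: well_order_on_def)
    then have "strict_ranking (students M) (W - Id)"
      by (auto simp: strict_ranking_def)
    then show ?thesis using True by blast
  next
    case False
    then obtain c where c: "c \<in> colleges M"
      by blast
    then have "strict_ranking (students M) (college_pref M c)"
      using M by (simp add: is_market_def)
    then show ?thesis
      using aligned[OF _ c] by blast
  qed
  then obtain L where "strict_ranking (students M) L" "\<forall>c\<in>colleges M. college_pref M c = L"
    by blast
  then have "master_list M L"
    using M by unfold_locales (auto simp: is_market_def)
  then show thesis by (rule that)
qed

theorem proposition11:
  shows "stable_mechanism_on (aligned_markets :: ('s, 'c, 'r) market set) CSD \<and>
    strategy_proof_on (aligned_markets :: ('s, 'c, 'r) market set) CSD"
proof
  show "stable_mechanism_on (aligned_markets :: ('s, 'c, 'r) market set) CSD"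
    unfolding stable_mechanism_on_def
    using aligned_market_master_list master_list.CSD_serial_outcome master_list.serial_outcome_stable
    by metis
  show "strategy_proof_on (aligned_markets :: ('s, 'c, 'r) market set) CSD"
    unfolding strategy_proof_on_def
  proof (intro ballI allI impI)
    fix M :: "('s, 'c, 'r) market" and s P \<mu> \<mu>'
    assume "M \<in> aligned_markets" and s: "s \<in> students M" and P: "strict_ranking (alternatives M) P"
      and \<mu>: "\<mu> \<in> set_pmf (CSD M)" and \<mu>': "\<mu>' \<in> set_pmf (CSD (misreport M s P))"
    then obtain L where L: "master_list M L"
      using aligned_market_master_list by blast
    show "(assigned \<mu>' s, assigned \<mu> s) \<notin> student_pref M s"
      \<comment> \<open>The same list \<open>L\<close> governs the true and the reported run, which
        makes their outcomes comparable.\<close>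
      using master_list.serial_outcome_misreport[OF L master_list.CSD_serial_outcome[OF L \<mu>]
          master_list.CSD_serial_outcome[OF master_list.master_list_misreport[OF L P] \<mu>'] s P] .
  qed
qed

end
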